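(* Let $n\ge1$, let $a=(a_1,a_2,a_3,a_4)$ be a vertex of $\Phi(\mathbb H(\mathbb Z_{2^n}))$, and let $B=\{b\in\mathbb H(\mathbb Z_{2^n}) : ab=0\}$. Then: (i) if $n=1$, $\deg(a)=2^{4n}-|B|-1$ when $a^2=0$, and $\deg(a)=2^{4n}-|B|-2$ when $a^2\neq0$; (ii) if $n>1$, $\deg(a)=2^{4n}-|B|-2$ when $a^2=0$, and $\deg(a)=2^{4n}-|B|-3$ when $a^2\neq0$. Moreover, $|B|=\prod_{i=1}^4\gcd(d_i,2^n)$, where $\operatorname{diag}(d_1,d_2,d_3,d_4)$ is the Smith normal form of the coefficient matrix $$\mathcal A=\begin{pmatrix}a_1&-a_2&-a_3&-a_4\\ a_2&a_1&-a_4&a_3\\ a_3&a_4&a_1&-a_2\\ a_4&-a_3&a_2&a_1\end{pmatrix}$$ of the linear system $ab=0$ in the unknowns $b=(b_1,b_2,b_3,b_4)$.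
   Context: $\mathbb H(\mathbb Z_{2^n})$ is the ring of Hamilton quaternions over $\mathbb Z_{2^n}$. Its elements are $a_1+a_2i+a_3j+a_4k$ with $a_i\in\mathbb Z_{2^n}$, written $(a_1,a_2,a_3,a_4)$. Addition is coordinatewise, and multiplication is determined by distributivity, scalars commuting with $i,j,k$, and $i^2=j^2=k^2=-1$, $ij=-ji=k$, $jk=-kj=i$, $ki=-ik=j$. Explicitly, $(a_1,a_2,a_3,a_4)(b_1,b_2,b_3,b_4)=(a_1b_1-a_2b_2-a_3b_3-a_4b_4,\ a_2b_1+a_1b_2-a_4b_3+a_3b_4,\ a_3b_1+a_4b_2+a_1b_3-a_2b_4,\ a_4b_1-a_3b_2+a_2b_3+a_1b_4)$ modulo $2^n$, so $ab=0$ is the linear congruence system $\mathcal A\,b^{T}\equiv0 \pmod{2^n}$. The graph $\Phi(\mathbb H(\mathbb Z_{2^n}))$ has vertex set $\mathbb H(\mathbb Z_{2^n})\setminus\{(0,0,0,0),(1,0,0,0),(2^n-1,0,0,0)\}$. For this ring the paper defines adjacency of distinct vertices $a,b$ by $ab\neq0$, so $\deg(a)$ is the number of vertices $b\neq a$ with $ab\neq0$. The Smith normal form is taken for the integer matrix obtained from integer representatives of the $a_i$. It is the diagonal matrix $\operatorname{diag}(d_1,\dots,d_4)$, with $d_1\mid d_2\mid d_3\mid d_4$, equivalent to $\mathcal A$ under invertible row and column operations, and some $d_i$ may be $0$, with $\gcd(0,2^n)=2^n$. *)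

theory Defs
  imports "HOL-Number_Theory.Residues" "Jordan_Normal_Form.Matrix"
begin

definition quaternion_ring :: "('a, 'm) ring_scheme \<Rightarrow> ('a \<times> 'a \<times> 'a \<times> 'a) ring" where
  "quaternion_ring R =
    \<lparr>carrier = carrier R \<times> carrier R \<times> carrier R \<times> carrier R,
     monoid.mult = (\<lambda>(a1, a2, a3, a4) (b1, b2, b3, b4).
       (a1 \<otimes>\<^bsub>R\<^esub> b1 \<ominus>\<^bsub>R\<^esub> a2 \<otimes>\<^bsub>R\<^esub> b2 \<ominus>\<^bsub>R\<^esub> a3 \<otimes>\<^bsub>R\<^esub> b3 \<ominus>\<^bsub>R\<^esub> a4 \<otimes>\<^bsub>R\<^esub> b4,
        a2 \<otimes>\<^bsub>R\<^esub> b1 \<oplus>\<^bsub>R\<^esub> a1 \<otimes>\<^bsub>R\<^esub> b2 \<ominus>\<^bsub>R\<^esub> a4 \<otimes>\<^bsub>R\<^esub> b3 \<oplus>\<^bsub>R\<^esub> a3 \<otimes>\<^bsub>R\<^esub> b4,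
        a3 \<otimes>\<^bsub>R\<^esub> b1 \<oplus>\<^bsub>R\<^esub> a4 \<otimes>\<^bsub>R\<^esub> b2 \<oplus>\<^bsub>R\<^esub> a1 \<otimes>\<^bsub>R\<^esub> b3 \<ominus>\<^bsub>R\<^esub> a2 \<otimes>\<^bsub>R\<^esub> b4,
        a4 \<otimes>\<^bsub>R\<^esub> b1 \<ominus>\<^bsub>R\<^esub> a3 \<otimes>\<^bsub>R\<^esub> b2 \<oplus>\<^bsub>R\<^esub> a2 \<otimes>\<^bsub>R\<^esub> b3 \<oplus>\<^bsub>R\<^esub> a1 \<otimes>\<^bsub>R\<^esub> b4)),
     one = (\<one>\<^bsub>R\<^esub>, \<zero>\<^bsub>R\<^esub>, \<zero>\<^bsub>R\<^esub>, \<zero>\<^bsub>R\<^esub>),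
     zero = (\<zero>\<^bsub>R\<^esub>, \<zero>\<^bsub>R\<^esub>, \<zero>\<^bsub>R\<^esub>, \<zero>\<^bsub>R\<^esub>),
     add = (\<lambda>(a1, a2, a3, a4) (b1, b2, b3, b4).
       (a1 \<oplus>\<^bsub>R\<^esub> b1, a2 \<oplus>\<^bsub>R\<^esub> b2, a3 \<oplus>\<^bsub>R\<^esub> b3, a4 \<oplus>\<^bsub>R\<^esub> b4))\<rparr>"

text \<open>The carrier of \<^term>\<open>residue_ring (2 ^ n)\<close> is \<open>{0..2 ^ n - 1}\<close>, so the coordinates below are
  the least nonnegative residues.\<close>

definition HZ :: "nat \<Rightarrow> (int \<times> int \<times> int \<times> int) ring" where
  "HZ n = quaternion_ring (residue_ring (2 ^ n))"

definition Phi_verts :: "nat \<Rightarrow> (int \<times> int \<times> int \<times> int) set" where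
  "Phi_verts n = carrier (HZ n) - {(0, 0, 0, 0), (1, 0, 0, 0), (2 ^ n - 1, 0, 0, 0)}"

definition Phi_adj :: "nat \<Rightarrow> int \<times> int \<times> int \<times> int \<Rightarrow> int \<times> int \<times> int \<times> int \<Rightarrow> bool" where
  "Phi_adj n a b \<longleftrightarrow>
    a \<in> Phi_verts n \<and> b \<in> Phi_verts n \<and> a \<noteq> b \<and> a \<otimes>\<^bsub>HZ n\<^esub> b \<noteq> \<zero>\<^bsub>HZ n\<^esub>"

definition Phi_deg :: "nat \<Rightarrow> int \<times> int \<times> int \<times> int \<Rightarrow> nat" where
  "Phi_deg n a = card {b. Phi_adj n a b}"

definition coeff_mat :: "int \<Rightarrow> int \<Rightarrow> int \<Rightarrow> int \<Rightarrow> int mat" where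
  "coeff_mat a1 a2 a3 a4 = mat_of_rows_list 4
    [[a1, - a2, - a3, - a4],
     [a2,   a1, - a4,   a3],
     [a3,   a4,   a1, - a2],
     [a4, - a3,   a2,   a1]]"

text \<open>No sign is imposed on the diagonal entries, so \<open>D\<close> is determined by \<open>A\<close> only up to the signs
  of its entries.\<close>

definition smith_normal_form_of :: "int mat \<Rightarrow> int mat \<Rightarrow> bool" where
  "smith_normal_form_of A D \<longleftrightarrow>
    D \<in> carrier_mat (dim_row A) (dim_col A) \<and>
    diagonal_mat D \<and>
    (\<forall>i. i + 1 < min (dim_row D) (dim_col D) \<longrightarrow> D $$ (i, i) dvd D $$ (i + 1, i + 1)) \<and>
    (\<exists>P Q. P \<in> carrier_mat (dim_row A) (dim_row A) \<and> invertible_mat P \<and>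
           Q \<in> carrier_mat (dim_col A) (dim_col A) \<and> invertible_mat Q \<and>
           D = P * A * Q)"

end

theory Submission
  imports Defs "Jordan_Normal_Form.Column_Operations"
begin

text \<open>
  A vertex \<open>a\<close> annihilates neither \<open>1\<close> nor \<open>-1\<close>, so its non-neighbours among all quaternions are
  \<open>B\<close>, the units \<open>1\<close> and \<open>-1\<close> (which coincide for \<open>n = 1\<close>), and \<open>a\<close> itself, which lies in \<open>B\<close> exactly when
  \<open>a\<^sup>2 = 0\<close>.

  If \<open>D = P A Q\<close> with \<open>P\<close>, \<open>Q\<close> invertible over the integers, then \<open>Q\<close> induces a bijection from the
  kernel of \<open>D\<close> modulo \<open>m\<close> onto that of \<open>A\<close>, and the kernel of a diagonal matrix splits into the
  solution sets of \<open>d\<^sub>i y = 0\<close>, each with \<open>gcd d\<^sub>i m\<close> elements. A Smith normal form exists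
  because a nonzero entry of least absolute value among all matrices equivalent to \<open>A\<close>, moved to
  the corner, divides its row and its column, and after clearing these also every other entry.
\<close>

section \<open>Equivalence of matrices\<close>

text \<open>Comparing column dimensions in the two inverse equations forces the inverse to be
  \<open>n\<close> by \<open>n\<close> as well, so that it can be used under explicit carrier
  conditions.\<close>

lemma invertible_mat_iff:
  assumes "P \<in> carrier_mat n n"
  shows "invertible_mat P \<longleftrightarrow> (\<exists>P' \<in> carrier_mat n n. P * P' = 1\<^sub>m n \<and> P' * P = 1\<^sub>m n)"
    (is "_ \<longleftrightarrow> ?R")
proof
  assume "invertible_mat P"
  then obtain P' where P': "P * P' = 1\<^sub>m n" "P' * P = 1\<^sub>m (dim_row P')"
    using assms by (auto simp: invertible_mat_def inverts_mat_def)
  from arg_cong[OF P'(1), of dim_col] arg_cong[OF P'(2), of dim_col]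
  have "P' \<in> carrier_mat n n"
    using assms by auto
  with P' show ?R by auto
qed (use assms in \<open>auto simp: invertible_mat_def inverts_mat_def square_mat.simps\<close>)

lemma invertible_mat_mult:
  fixes P Q :: "'a :: semiring_1 mat"
  assumes "P \<in> carrier_mat n n" "Q \<in> carrier_mat n n" "invertible_mat P" "invertible_mat Q"
  shows "invertible_mat (P * Q)"
proof -
  obtain P' where P': "P' \<in> carrier_mat n n" "P * P' = 1\<^sub>m n" "P' * P = 1\<^sub>m n"
    using assms invertible_mat_iff by blast
  obtain Q' where Q': "Q' \<in> carrier_mat n n" "Q * Q' = 1\<^sub>m n" "Q' * Q = 1\<^sub>m n"
    using assms invertible_mat_iff by blast
  have "(P * Q) * (Q' * P') = P * (Q * Q') * P'"
    using assms P'(1) Q'(1) by (simp add: assoc_mult_mat[of _ n n _ n _ n])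
  moreover have "(Q' * P') * (P * Q) = Q' * (P' * P) * Q"
    using assms P'(1) Q'(1) by (simp add: assoc_mult_mat[of _ n n _ n _ n])
  ultimately have "(P * Q) * (Q' * P') = 1\<^sub>m n \<and> (Q' * P') * (P * Q) = 1\<^sub>m n"
    using assms(1,2) P' Q' by simp
  then show ?thesis
    using invertible_mat_iff[of "P * Q" n] assms(1,2) P'(1) Q'(1) by (metis mult_carrier_mat)
qed

lemma invertible_one_mat: "invertible_mat (1\<^sub>m n)"
  by (auto simp: invertible_mat_iff[of _ n] intro!: bexI[of _ "1\<^sub>m n"])

lemma invertible_addrow_mat:
  assumes "k < n" "l < n" "k \<noteq> l"
  shows "invertible_mat (addrow_mat n (c :: 'a :: comm_ring_1) k l)"
  using addrow_mat_inv[OF assms, of c] addrow_mat_inv[OF assms, of "- c"]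
  by (auto simp: invertible_mat_iff[of _ n])

lemma invertible_swaprows_mat:
  assumes "k < n" "l < n"
  shows "invertible_mat (swaprows_mat n k l)"
  using swaprows_mat_inv[OF assms] by (auto simp: invertible_mat_iff[of _ n])

text \<open>This is the transformation clause of \<open>smith_normal_form_of\<close> on its own:
  separated from diagonality and divisibility it is reflexive and transitive, so single operations
  can be chained.\<close>

definition equiv_mat :: "'a :: semiring_1 mat \<Rightarrow> 'a mat \<Rightarrow> bool" where
  "equiv_mat A B \<longleftrightarrow>
    (\<exists>P Q. P \<in> carrier_mat (dim_row A) (dim_row A) \<and> invertible_mat P \<and>
           Q \<in> carrier_mat (dim_col A) (dim_col A) \<and> invertible_mat Q \<and> B = P * A * Q)"

lemma equiv_matI:
  assumes "A \<in> carrier_mat m n" "P \<in> carrier_mat m m" "invertible_mat P"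
    "Q \<in> carrier_mat n n" "invertible_mat Q" "B = P * A * Q"
  shows "equiv_mat A B"
  unfolding equiv_mat_def using assms by (intro exI[of _ P] exI[of _ Q]) simp

lemma equiv_mat_carrier:
  assumes "equiv_mat A B" "A \<in> carrier_mat m n"
  shows "B \<in> carrier_mat m n"
  using assms unfolding equiv_mat_def by auto

lemma equiv_mat_refl: "equiv_mat A A"
  by (rule equiv_matI[of A "dim_row A" "dim_col A" "1\<^sub>m (dim_row A)" "1\<^sub>m (dim_col A)"])
    (auto simp: invertible_one_mat)

lemma equiv_mat_trans:
  assumes "equiv_mat A B" "equiv_mat B C"
  shows "equiv_mat A C"
proof -
  define m n where "m = dim_row A" and "n = dim_col A"
  have A: "A \<in> carrier_mat m n"
    by (simp add: m_def n_def)
  have B: "B \<in> carrier_mat m n"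
    using equiv_mat_carrier[OF assms(1) A] .
  obtain P Q where PQ: "P \<in> carrier_mat m m" "invertible_mat P" "Q \<in> carrier_mat n n"
    "invertible_mat Q" "B = P * A * Q"
    using assms(1) A unfolding equiv_mat_def by auto
  obtain P' Q' where PQ': "P' \<in> carrier_mat m m" "invertible_mat P'" "Q' \<in> carrier_mat n n"
    "invertible_mat Q'" "C = P' * B * Q'"
    using assms(2) B unfolding equiv_mat_def by auto
  have "C = (P' * P) * A * (Q * Q')"
    using A PQ(1,3) PQ'(1,3) unfolding PQ'(5) PQ(5)
    by (simp add: assoc_mult_mat[of _ m m _ n _ n] assoc_mult_mat[of _ m n _ n _ n]
        assoc_mult_mat[of _ m m _ m _ n])
  with A PQ PQ' show ?thesis
    by (intro equiv_matI[of A m n "P' * P" "Q * Q'"]) (auto intro: invertible_mat_mult)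
qed

lemma equiv_mat_mult_left:
  assumes "A \<in> carrier_mat m n" "P \<in> carrier_mat m m" "invertible_mat P"
  shows "equiv_mat A (P * A)"
  using assms by (intro equiv_matI[of A m n P "1\<^sub>m n"]) (auto simp: invertible_one_mat)

lemma equiv_mat_mult_right:
  assumes "A \<in> carrier_mat m n" "Q \<in> carrier_mat n n" "invertible_mat Q"
  shows "equiv_mat A (A * Q)"
  using assms by (intro equiv_matI[of A m n "1\<^sub>m m" Q]) (auto simp: invertible_one_mat)

section \<open>Elementary row and column operations\<close>

lemma equiv_mat_addrow:
  fixes A :: "'a :: comm_ring_1 mat"
  assumes "k < dim_row A" "l < dim_row A" "k \<noteq> l"
  shows "equiv_mat A (addrow c k l A)"
  using assms addrow_mat[of A "dim_row A" "dim_col A" l c k]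
  by (auto intro!: equiv_mat_mult_left[of _ "dim_row A" "dim_col A"] invertible_addrow_mat)

lemma equiv_mat_addcol:
  fixes A :: "'a :: comm_ring_1 mat"
  assumes "k < dim_col A" "l < dim_col A" "k \<noteq> l"
  shows "equiv_mat A (addcol c k l A)"
  using assms addcol_mat[of A "dim_row A" "dim_col A" l c k]
  by (auto intro!: equiv_mat_mult_right[of _ "dim_row A" "dim_col A"] invertible_addrow_mat)

lemma equiv_mat_swaprows:
  assumes "k < dim_row A" "l < dim_row A"
  shows "equiv_mat A (swaprows k l A)"
  using assms swaprows_mat[of A "dim_row A" "dim_col A" k l]
  by (auto intro!: equiv_mat_mult_left[of _ "dim_row A" "dim_col A"] invertible_swaprows_mat)

lemma equiv_mat_swapcols:
  assumes "k < dim_col A" "l < dim_col A"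
  shows "equiv_mat A (swapcols k l A)"
  using assms swapcols_mat[of A "dim_row A" "dim_col A" k l]
  by (auto intro!: equiv_mat_mult_right[of _ "dim_row A" "dim_col A"] invertible_swaprows_mat)

section \<open>Block matrices and block elimination\<close>

lemma invertible_four_block_lower:
  fixes C :: "'a :: comm_ring_1 mat"
  assumes "C \<in> carrier_mat n m"
  shows "invertible_mat (four_block_mat (1\<^sub>m m) (0\<^sub>m m n) C (1\<^sub>m n))"
proof -
  have [simp]: "- (0\<^sub>m m m :: 'a mat) = 0\<^sub>m m m" "C + - C = 0\<^sub>m n m"
    using assms by auto
  let ?F = "\<lambda>C. four_block_mat (1\<^sub>m m) (0\<^sub>m m n) C (1\<^sub>m n)"
  \<comment> \<open>Unitriangular block matrices multiply by adding their off-diagonal blocks, so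
    negating that block gives the inverse.\<close>
  have "?F C * ?F (- C) = 1\<^sub>m (m + n)" "?F (- C) * ?F C = 1\<^sub>m (m + n)"
    using assms by (subst mult_four_block_mat[where ?nr1.0 = m and ?n1.0 = m and ?nc1.0 = m
          and ?nr2.0 = n and ?n2.0 = n and ?nc2.0 = n]; simp)+
  then show ?thesis
    using assms by (subst invertible_mat_iff[of _ "m + n"]) (auto intro!: bexI[of _ "?F (- C)"])
qed

lemma invertible_four_block_upper:
  fixes B :: "'a :: comm_ring_1 mat"
  assumes "B \<in> carrier_mat m n"
  shows "invertible_mat (four_block_mat (1\<^sub>m m) B (0\<^sub>m n m) (1\<^sub>m n))"
proof -
  let ?F = "\<lambda>B. four_block_mat (1\<^sub>m m) B (0\<^sub>m n m) (1\<^sub>m n)"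
  have [simp]: "- (0\<^sub>m n n :: 'a mat) = 0\<^sub>m n n" "B + - B = 0\<^sub>m m n"
    using assms by auto
  have "?F B * ?F (- B) = 1\<^sub>m (m + n)" "?F (- B) * ?F B = 1\<^sub>m (m + n)"
    using assms by (subst mult_four_block_mat[where ?nr1.0 = m and ?n1.0 = m and ?nc1.0 = m
          and ?nr2.0 = n and ?n2.0 = n and ?nc2.0 = n]; simp)+
  then show ?thesis
    using assms by (subst invertible_mat_iff[of _ "m + n"]) (auto intro!: bexI[of _ "?F (- B)"])
qed

lemma invertible_four_block_diag:
  fixes P Q :: "'a :: semiring_1 mat"
  assumes "P \<in> carrier_mat m m" "Q \<in> carrier_mat n n" "invertible_mat P" "invertible_mat Q"
  shows "invertible_mat (four_block_mat P (0\<^sub>m m n) (0\<^sub>m n m) Q)"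
proof -
  obtain P' where P': "P' \<in> carrier_mat m m" "P * P' = 1\<^sub>m m" "P' * P = 1\<^sub>m m"
    using assms invertible_mat_iff by blast
  obtain Q' where Q': "Q' \<in> carrier_mat n n" "Q * Q' = 1\<^sub>m n" "Q' * Q = 1\<^sub>m n"
    using assms invertible_mat_iff by blast
  let ?F = "\<lambda>P Q. four_block_mat P (0\<^sub>m m n) (0\<^sub>m n m) Q"
  have "?F P Q * ?F P' Q' = 1\<^sub>m (m + n)" "?F P' Q' * ?F P Q = 1\<^sub>m (m + n)"
    using assms P' Q' by (subst mult_four_block_mat[where ?nr1.0 = m and ?n1.0 = m and ?nc1.0 = m
          and ?nr2.0 = n and ?n2.0 = n and ?nc2.0 = n]; simp)+
  then show ?thesis
    using assms P'(1) Q'(1)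
    by (subst invertible_mat_iff[of _ "m + n"]) (auto intro!: bexI[of _ "?F P' Q'"])
qed

text \<open>Extending the transformations of \<open>B\<close> by identity blocks leaves
  \<open>A\<close> untouched. This lifts a reduction of the lower right block to the whole
  matrix.\<close>

lemma equiv_mat_four_block_diag:
  fixes A B :: "'a :: semiring_1 mat"
  assumes "A \<in> carrier_mat m1 n1" "B \<in> carrier_mat m2 n2" "equiv_mat B B'"
  shows "equiv_mat (four_block_mat A (0\<^sub>m m1 n2) (0\<^sub>m m2 n1) B)
    (four_block_mat A (0\<^sub>m m1 n2) (0\<^sub>m m2 n1) B')"
proof -
  obtain P Q where PQ: "P \<in> carrier_mat m2 m2" "invertible_mat P" "Q \<in> carrier_mat n2 n2"
    "invertible_mat Q" "B' = P * B * Q"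
    using assms unfolding equiv_mat_def by auto
  let ?P = "four_block_mat (1\<^sub>m m1) (0\<^sub>m m1 m2) (0\<^sub>m m2 m1) P"
  let ?Q = "four_block_mat (1\<^sub>m n1) (0\<^sub>m n1 n2) (0\<^sub>m n2 n1) Q"
  let ?A = "four_block_mat A (0\<^sub>m m1 n2) (0\<^sub>m m2 n1) B"
  have "?P * ?A = four_block_mat A (0\<^sub>m m1 n2) (0\<^sub>m m2 n1) (P * B)"
    using assms(1,2) PQ(1) by (subst mult_four_block_mat[where ?nr1.0 = m1 and ?n1.0 = m1
          and ?nc1.0 = n1 and ?nr2.0 = m2 and ?n2.0 = m2 and ?nc2.0 = n2]) auto
  then have "?P * ?A * ?Q = four_block_mat A (0\<^sub>m m1 n2) (0\<^sub>m m2 n1) (P * B * Q)"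
    using assms(1,2) PQ(1,3) by (simp, subst mult_four_block_mat[where ?nr1.0 = m1 and ?n1.0 = n1
          and ?nc1.0 = n1 and ?nr2.0 = m2 and ?n2.0 = n2 and ?nc2.0 = n2]) auto
  then show ?thesis
    using assms(1,2) PQ
    by (intro equiv_matI[of _ "m1 + m2" "n1 + n2" ?P ?Q])
      (auto intro!: invertible_four_block_diag invertible_one_mat)
qed

text \<open>Block Gaussian elimination: left multiplication by \<open>?P\<close> subtracts
  \<open>C\<close> times the first block row from the second, and right multiplication by
  \<open>?Q\<close> then subtracts the first block column times \<open>B\<close> from the second.
  Having the off-diagonal blocks as multiples of \<open>A\<close> replaces inverting
  \<open>A\<close>.\<close>

lemma equiv_mat_four_block_clear:
  fixes A :: "'a :: comm_ring_1 mat"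
  assumes A: "A \<in> carrier_mat m1 n1" and B: "B \<in> carrier_mat n1 n2"
    and C: "C \<in> carrier_mat m2 m1" and D: "D \<in> carrier_mat m2 n2"
  shows "equiv_mat (four_block_mat A (A * B) (C * A) D)
    (four_block_mat A (0\<^sub>m m1 n2) (0\<^sub>m m2 n1) (D - C * (A * B)))"
proof -
  let ?P = "four_block_mat (1\<^sub>m m1) (0\<^sub>m m1 m2) (- C) (1\<^sub>m m2)"
  let ?Q = "four_block_mat (1\<^sub>m n1) (- B) (0\<^sub>m n2 n1) (1\<^sub>m n2)"
  let ?A = "four_block_mat A (A * B) (C * A) D"
  have [simp]: "- (C * A) + C * A = 0\<^sub>m m2 n1" "- (A * B) + A * B = 0\<^sub>m m1 n2"
    using A B C by (auto intro!: eq_matI)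
  have [simp]: "- (C * (A * B)) + D = D - C * (A * B)"
    using A B C D by (auto intro!: eq_matI)
  have "?P * ?A = four_block_mat A (A * B) (0\<^sub>m m2 n1) (D - C * (A * B))"
    using A B C D by (subst mult_four_block_mat[where ?nr1.0 = m1 and ?n1.0 = m1
          and ?nc1.0 = n1 and ?nr2.0 = m2 and ?n2.0 = m2 and ?nc2.0 = n2]) auto
  then have "?P * ?A * ?Q = four_block_mat A (0\<^sub>m m1 n2) (0\<^sub>m m2 n1) (D - C * (A * B))"
    using A B C D by (simp, subst mult_four_block_mat[where ?nr1.0 = m1 and ?n1.0 = n1
          and ?nc1.0 = n1 and ?nr2.0 = m2 and ?n2.0 = n2 and ?nc2.0 = n2])
      (auto simp: minus_carrier_mat)
  then show ?thesis
    using A B C D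
    by (intro equiv_matI[of _ "m1 + m2" "n1 + n2" ?P ?Q])
      (auto intro!: invertible_four_block_lower invertible_four_block_upper)
qed

section \<open>Smith normal form over the integers\<close>

text \<open>Each entry of \<open>P * A * Q\<close> is a linear combination of entries of
  \<open>A\<close>, so common divisors persist.\<close>

lemma equiv_mat_entries_dvd:
  fixes A :: "'a :: comm_ring_1 mat"
  assumes "equiv_mat A B" and "A \<in> carrier_mat m n"
    and dvd: "\<And>i j. i < m \<Longrightarrow> j < n \<Longrightarrow> d dvd A $$ (i, j)"
    and "i < m" "j < n"
  shows "d dvd B $$ (i, j)"
proof -
  obtain P Q where PQ: "P \<in> carrier_mat m m" "Q \<in> carrier_mat n n" "B = P * A * Q"
    using assms(1,2) unfolding equiv_mat_def by auto
  have PA: "d dvd (P * A) $$ (i, k)" if "k < n" for k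
    using that assms(2,4) PQ(1) dvd by (auto simp: scalar_prod_def intro!: dvd_sum)
  obtain X where X: "X = P * A" "X \<in> carrier_mat m n"
    using PQ(1) assms(2) by auto
  have "B $$ (i, j) = (\<Sum>k = 0..<n. X $$ (i, k) * Q $$ (k, j))"
    unfolding PQ(3) X(1)[symmetric] using assms(4,5) PQ(2) X(2) by (simp add: scalar_prod_def)
  with PA X(1) show ?thesis
    by (auto intro!: dvd_sum)
qed

lemma smith_normal_form_of_iff:
  "smith_normal_form_of A D \<longleftrightarrow> equiv_mat A D \<and> diagonal_mat D \<and>
    (\<forall>i. i + 1 < min (dim_row D) (dim_col D) \<longrightarrow> D $$ (i, i) dvd D $$ (i + 1, i + 1))"
  unfolding smith_normal_form_of_def using equiv_mat_carrier[of A D]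
  by (auto simp: equiv_mat_def simp del: assoc_mult_mat)

text \<open>The minimum is taken over all matrices equivalent to \<open>A\<close>, not just over the
  entries of one matrix. Hence it still bounds the entries after any further operations.\<close>

lemma smallest_entry_pivot:
  fixes A :: "int mat"
  assumes A: "A \<in> carrier_mat m n" and nz: "i < m" "j < n" "A $$ (i, j) \<noteq> 0"
  obtains B where "equiv_mat A B" "B $$ (0, 0) \<noteq> 0"
    "\<And>C i j. equiv_mat A C \<Longrightarrow> i < m \<Longrightarrow> j < n \<Longrightarrow> C $$ (i, j) \<noteq> 0 \<Longrightarrow>
       \<bar>B $$ (0, 0)\<bar> \<le> \<bar>C $$ (i, j)\<bar>"
proof -
  \<comment> \<open>Minimizing over triples treats the matrix and the position at once.\<close>
  define E where "E = (\<lambda>(C, i, j). equiv_mat A C \<and> i < m \<and> j < n \<and> C $$ (i, j) \<noteq> 0)"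
  have "E (A, i, j)"
    using nz by (simp add: E_def equiv_mat_refl)
  from ex_has_least_nat[of E, OF this, of "\<lambda>(C, i, j). nat \<bar>C $$ (i, j)\<bar>"]
  obtain C k l where C: "equiv_mat A C" "k < m" "l < n" "C $$ (k, l) \<noteq> 0"
    and least: "\<And>C' i j. equiv_mat A C' \<Longrightarrow> i < m \<Longrightarrow> j < n \<Longrightarrow> C' $$ (i, j) \<noteq> 0 \<Longrightarrow>
       \<bar>C $$ (k, l)\<bar> \<le> \<bar>C' $$ (i, j)\<bar>"
    by (fastforce simp: E_def)
  have carr: "C \<in> carrier_mat m n"
    using equiv_mat_carrier[OF C(1) A] .
  \<comment> \<open>Two swaps bring the minimal entry to the corner without changing its
    value.\<close>
  define B where "B = swapcols 0 l (swaprows 0 k C)"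
  have "equiv_mat A B"
    unfolding B_def using carr C(2,3)
    by (intro equiv_mat_trans[OF equiv_mat_trans[OF C(1)] equiv_mat_swapcols] equiv_mat_swaprows)
      auto
  moreover have "B $$ (0, 0) = C $$ (k, l)"
    using carr C(2,3) by (auto simp: B_def)
  ultimately show thesis
    using that C(4) least by metis
qed

theorem smith_normal_form_exists:
  fixes A :: "int mat"
  shows "\<exists>D. smith_normal_form_of A D"
proof -
  define m n where "m = dim_row A" and "n = dim_col A"
  have "A \<in> carrier_mat m n"
    by (simp add: m_def n_def)
  then show ?thesis
  proof (induction m arbitrary: n A)
    case 0
    then show ?case
      by (intro exI[of _ A]) (auto simp: smith_normal_form_of_iff equiv_mat_refl diagonal_mat_def)
  next
    case (Suc m)
    show ?case
    proof (cases "\<exists>i<Suc m. \<exists>j<n. A $$ (i, j) \<noteq> 0")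
      \<comment> \<open>This covers \<open>n = 0\<close> too. A zero matrix is its own Smith normal
        form because 0 divides 0.\<close>
      case False
      then show ?thesis
        using Suc.prems
        by (intro exI[of _ A]) (auto simp: smith_normal_form_of_iff equiv_mat_refl diagonal_mat_def)
    next
      case True
      then obtain n' where n: "n = Suc n'"
        by (cases n) auto
      from True obtain B where B: "equiv_mat A B" "B $$ (0, 0) \<noteq> 0"
        and least: "\<And>C i j. equiv_mat A C \<Longrightarrow> i < Suc m \<Longrightarrow> j < n \<Longrightarrow> C $$ (i, j) \<noteq> 0 \<Longrightarrow>
          \<bar>B $$ (0, 0)\<bar> \<le> \<bar>C $$ (i, j)\<bar>"
        using smallest_entry_pivot[OF Suc.prems] by metis
      define d where "d = B $$ (0, 0)"
      \<comment> \<open>A remainder modulo \<open>d\<close> is smaller than \<open>d\<close> in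
        absolute value, whatever the sign of \<open>d\<close>. By minimality it can occur in an
        equivalent matrix only as 0.\<close>
      have mod_zero: "x mod d = 0"
        if "equiv_mat A C" "i < Suc m" "j < n" "C $$ (i, j) = x mod d" for C i j x
        using least[OF that(1-3)] that(4) B(2) abs_mod_less[of d x] by (auto simp: d_def)
      \<comment> \<open>A suitable multiple of column 0 added to column \<open>j\<close> leaves the
        remainder of the entry modulo \<open>d\<close>. The claim is made for every equivalent
        \<open>C\<close> with corner \<open>d\<close>, because it is applied again below to a matrix
        other than \<open>B\<close>.\<close>
      have row: "d dvd C $$ (0, j)" if C: "equiv_mat A C" "C $$ (0, 0) = d" "j < n" for C j
      proof (cases "j = 0")
        case False
        have carr: "C \<in> carrier_mat (Suc m) n"
          using equiv_mat_carrier[OF C(1) Suc.prems] .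
        let ?C = "addcol (- (C $$ (0, j) div d)) j 0 C"
        have "?C $$ (0, j) = C $$ (0, j) mod d"
          using carr C(2,3) by (simp add: minus_div_mult_eq_mod[symmetric])
        moreover have "equiv_mat A ?C"
          using carr C False by (intro equiv_mat_trans[OF C(1) equiv_mat_addcol]) auto
        ultimately have "C $$ (0, j) mod d = 0"
          using mod_zero C(3) by blast
        then show ?thesis
          by (simp add: dvd_eq_mod_eq_0)
      qed (use that in simp)
      have col: "d dvd C $$ (i, 0)" if C: "equiv_mat A C" "C $$ (0, 0) = d" "i < Suc m" for C i
      proof (cases "i = 0")
        case False
        have carr: "C \<in> carrier_mat (Suc m) n"
          using equiv_mat_carrier[OF C(1) Suc.prems] .
        let ?C = "addrow (- (C $$ (i, 0) div d)) i 0 C"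
        have "?C $$ (i, 0) = C $$ (i, 0) mod d"
          using carr C(2,3) n by (simp add: minus_div_mult_eq_mod[symmetric])
        moreover have "equiv_mat A ?C"
          using carr C False by (intro equiv_mat_trans[OF C(1) equiv_mat_addrow]) auto
        ultimately have "C $$ (i, 0) mod d = 0"
          using mod_zero C(3) n by blast
        then show ?thesis
          by (simp add: dvd_eq_mod_eq_0)
      qed (use that in simp)
      have carrB: "B \<in> carrier_mat (Suc m) n"
        using equiv_mat_carrier[OF B(1) Suc.prems] .
      define D1 where "D1 = mat 1 1 (\<lambda>_. d)"
      define R where "R = mat 1 n' (\<lambda>(i, j). B $$ (0, Suc j) div d)"
      define L where "L = mat m 1 (\<lambda>(i, j). B $$ (Suc i, 0) div d)"
      define M where "M = mat m n' (\<lambda>(i, j). B $$ (Suc i, Suc j))"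
      define C where "C = M - L * (D1 * R)"
      have carr: "D1 \<in> carrier_mat 1 1" "R \<in> carrier_mat 1 n'" "L \<in> carrier_mat m 1"
        "M \<in> carrier_mat m n'" "C \<in> carrier_mat m n'"
        by (auto simp: D1_def R_def L_def M_def C_def intro!: minus_carrier_mat)
      \<comment> \<open>The divisions by \<open>d\<close> in \<open>R\<close> and \<open>L\<close>
        are exact, so the first row and column have the form required for block elimination.\<close>
      have "B = four_block_mat D1 (D1 * R) (L * D1) M"
        using carrB n row[OF B(1)] col[OF B(1)]
        by (intro eq_matI) (auto simp: D1_def R_def L_def M_def d_def scalar_prod_def)
      then have "equiv_mat B (four_block_mat D1 (0\<^sub>m 1 n') (0\<^sub>m m 1) C)" (is "equiv_mat B ?F")
        unfolding C_def using equiv_mat_four_block_clear[OF carr(1-4)] by simp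
      from equiv_mat_trans[OF B(1) this] have AF: "equiv_mat A ?F" .
      have carrF: "?F \<in> carrier_mat (Suc m) n"
        using four_block_carrier_mat[OF carr(1,5)] n by simp
      have dvd_C: "d dvd C $$ (i, j)" if "i < m" "j < n'" for i j
      proof -
        \<comment> \<open>Adding a lower row to row 0 keeps the corner, since that row starts with
          0, and copies a row of \<open>C\<close> into row 0, where \<open>row\<close>
          applies.\<close>
        let ?F' = "addrow 1 0 (Suc i) ?F"
        have "equiv_mat A ?F'"
          using carrF that by (intro equiv_mat_trans[OF AF equiv_mat_addrow]) auto
        moreover have "?F' $$ (0, 0) = d" "?F' $$ (0, Suc j) = C $$ (i, j)"
          using carrF carr that n by (auto simp: D1_def)
        ultimately show ?thesis
          using row[of ?F' "Suc j"] that n by simp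
      qed
      obtain E where E: "equiv_mat C E" "diagonal_mat E"
        "\<And>i. i + 1 < min (dim_row E) (dim_col E) \<Longrightarrow> E $$ (i, i) dvd E $$ (i + 1, i + 1)"
        using Suc.IH[OF carr(5)] by (auto simp: smith_normal_form_of_iff)
      have carrE: "E \<in> carrier_mat m n'"
        using equiv_mat_carrier[OF E(1) carr(5)] .
      \<comment> \<open>This supplies the first link of the divisibility chain, from
        \<open>d\<close> to the leading entry of \<open>E\<close>. The later links are those of
        \<open>E\<close>, shifted by one index.\<close>
      have dvd_E: "d dvd E $$ (i, j)" if "i < m" "j < n'" for i j
        using equiv_mat_entries_dvd[OF E(1) carr(5) dvd_C that] .
      let ?D = "four_block_mat D1 (0\<^sub>m 1 n') (0\<^sub>m m 1) E"
      have "equiv_mat A ?D"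
        using equiv_mat_trans[OF AF equiv_mat_four_block_diag[OF carr(1,5) E(1)]] .
      moreover have "diagonal_mat ?D"
        using E(2) carrE carr(1) by (auto simp: diagonal_mat_def)
      moreover have "?D $$ (i, i) dvd ?D $$ (i + 1, i + 1)"
        if "i + 1 < min (dim_row ?D) (dim_col ?D)" for i
        using that carrE carr(1) dvd_E[of 0 0] E(3)[of "i - 1"] by (cases i) (auto simp: D1_def)
      ultimately show ?thesis
        by (auto simp: smith_normal_form_of_iff)
    qed
  qed
qed

section \<open>Kernels modulo an integer\<close>

text \<open>Solutions modulo \<open>m\<close> are represented by least nonnegative residues, which
  makes the set finite for counting and matches the coordinates of \<open>HZ\<close>.\<close>

definition kernel_mod :: "int \<Rightarrow> int mat \<Rightarrow> int vec set" where
  "kernel_mod m A = {v \<in> carrier_vec (dim_col A). (\<forall>j<dim_col A. v $ j \<in> {0..<m}) \<and>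
     (\<forall>i<dim_row A. [(A *\<^sub>v v) $ i = 0] (mod m))}"

lemma cong_mult_mat_vec:
  fixes A :: "int mat"
  assumes "A \<in> carrier_mat k n" "v \<in> carrier_vec n" "w \<in> carrier_vec n"
    and "\<And>j. j < n \<Longrightarrow> [v $ j = w $ j] (mod m)" and "i < k"
  shows "[(A *\<^sub>v v) $ i = (A *\<^sub>v w) $ i] (mod m)"
proof -
  have "(A *\<^sub>v x) $ i = (\<Sum>j = 0..<n. A $$ (i, j) * x $ j)" if "x \<in> carrier_vec n" for x
    using assms(1,5) that by (auto simp: scalar_prod_def)
  with assms show ?thesis
    by (auto intro!: cong_sum cong_mult)
qed

lemma cong_mult_mat_vec_zero:
  fixes A :: "int mat"
  assumes "A \<in> carrier_mat k n" "v \<in> carrier_vec n"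
    and "\<And>j. j < n \<Longrightarrow> [v $ j = 0] (mod m)" and "i < k"
  shows "[(A *\<^sub>v v) $ i = 0] (mod m)"
proof -
  have "[(A *\<^sub>v v) $ i = (A *\<^sub>v 0\<^sub>v n) $ i] (mod m)"
    using assms by (intro cong_mult_mat_vec[of A k n]) (auto simp del: index_mult_mat_vec)
  then show ?thesis
    using assms by simp
qed

text \<open>\<open>Q\<close> changes the unknowns bijectively modulo \<open>m\<close>, with
  \<open>Q'\<close> giving the inverse map, while \<open>P\<close> merely recombines the equations
  and can be undone by \<open>P'\<close>.\<close>

lemma card_kernel_mod_equiv:
  assumes "equiv_mat A B" "m > 0"
  shows "card (kernel_mod m B) = card (kernel_mod m A)"
proof -
  define k n where "k = dim_row A" and "n = dim_col A"
  have A: "A \<in> carrier_mat k n"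
    by (simp add: k_def n_def)
  obtain P Q where P: "P \<in> carrier_mat k k" "invertible_mat P"
    and Q: "Q \<in> carrier_mat n n" "invertible_mat Q" and B: "B = P * A * Q"
    using assms(1) A unfolding equiv_mat_def by auto
  obtain P' where P': "P' \<in> carrier_mat k k" "P' * P = 1\<^sub>m k"
    using P invertible_mat_iff by blast
  obtain Q' where Q': "Q' \<in> carrier_mat n n" "Q * Q' = 1\<^sub>m n" "Q' * Q = 1\<^sub>m n"
    using Q invertible_mat_iff by blast
  \<comment> \<open>Multiplying by \<open>Q\<close> or \<open>Q'\<close> leaves the range of least
    residues, and \<open>red\<close> returns to it.\<close>
  define red where "red v = map_vec (\<lambda>x. x mod m) v" for v
  have red: "red v \<in> carrier_vec n" "j < n \<Longrightarrow> red v $ j \<in> {0..<m}"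
    "j < n \<Longrightarrow> [red v $ j = v $ j] (mod m)" if "v \<in> carrier_vec n" for v j
    using that assms(2) by (auto simp: red_def)
  have red_eqI: "red v = w" if "v \<in> carrier_vec n" "w \<in> carrier_vec n"
    "\<And>j. j < n \<Longrightarrow> w $ j \<in> {0..<m}" "\<And>j. j < n \<Longrightarrow> [v $ j = w $ j] (mod m)" for v w
    using that by (intro eq_vecI) (auto simp: red_def cong_def)
  have carrB: "B \<in> carrier_mat k n"
    using A P(1) Q(1) B by simp
  have kerA: "kernel_mod m A = {v \<in> carrier_vec n. (\<forall>j<n. v $ j \<in> {0..<m}) \<and>
      (\<forall>i<k. [(A *\<^sub>v v) $ i = 0] (mod m))}"
    and kerB: "kernel_mod m B = {v \<in> carrier_vec n. (\<forall>j<n. v $ j \<in> {0..<m}) \<and>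
      (\<forall>i<k. [(B *\<^sub>v v) $ i = 0] (mod m))}"
    using A carrB by (auto simp: kernel_mod_def simp del: index_mult_mat_vec)
  have Bv: "B *\<^sub>v v = P *\<^sub>v (A *\<^sub>v (Q *\<^sub>v v))" if "v \<in> carrier_vec n" for v
    using that A P(1) Q(1) unfolding B
    by (simp add: assoc_mult_mat_vec[of _ k n _ n] assoc_mult_mat_vec[of _ k k _ n])
  have inv: "Q' *\<^sub>v (Q *\<^sub>v v) = v" "Q *\<^sub>v (Q' *\<^sub>v v) = v" if "v \<in> carrier_vec n" for v
    using that Q(1) Q' by (simp_all add: assoc_mult_mat_vec[of _ n n _ n, symmetric])
  \<comment> \<open>Cancelling \<open>P\<close> turns solutions of the system for \<open>B\<close>
    into solutions of the system for \<open>A\<close>; \<open>Bv\<close> serves the converse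
    direction.\<close>
  have PAv: "P' *\<^sub>v (B *\<^sub>v v) = A *\<^sub>v (Q *\<^sub>v v)" if "v \<in> carrier_vec n" for v
    using that A P(1) Q(1) P' Bv[OF that]
    by (simp add: assoc_mult_mat_vec[of _ k k _ k, symmetric])
  have "bij_betw (\<lambda>v. red (Q *\<^sub>v v)) (kernel_mod m B) (kernel_mod m A)"
  proof (rule bij_betw_byWitness[where f' = "\<lambda>v. red (Q' *\<^sub>v v)"])
    show "\<forall>v\<in>kernel_mod m B. red (Q' *\<^sub>v red (Q *\<^sub>v v)) = v"
    proof
      fix v assume "v \<in> kernel_mod m B"
      then have v: "v \<in> carrier_vec n" "\<And>j. j < n \<Longrightarrow> v $ j \<in> {0..<m}"
        by (auto simp: kerB simp del: index_mult_mat_vec)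
      show "red (Q' *\<^sub>v red (Q *\<^sub>v v)) = v"
      proof (rule red_eqI)
        fix j assume "j < n"
        then have "[(Q' *\<^sub>v red (Q *\<^sub>v v)) $ j = (Q' *\<^sub>v (Q *\<^sub>v v)) $ j] (mod m)"
          using Q(1) Q'(1) v(1) red
          by (intro cong_mult_mat_vec[of Q' n n]) (auto simp del: index_mult_mat_vec)
        then show "[(Q' *\<^sub>v red (Q *\<^sub>v v)) $ j = v $ j] (mod m)"
          using inv v(1) by simp
      qed (use Q(1) Q'(1) v red in \<open>auto simp del: index_mult_mat_vec\<close>)
    qed
    show "\<forall>v\<in>kernel_mod m A. red (Q *\<^sub>v red (Q' *\<^sub>v v)) = v"
    proof
      fix v assume "v \<in> kernel_mod m A"
      then have v: "v \<in> carrier_vec n" "\<And>j. j < n \<Longrightarrow> v $ j \<in> {0..<m}"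
        by (auto simp: kerA simp del: index_mult_mat_vec)
      show "red (Q *\<^sub>v red (Q' *\<^sub>v v)) = v"
      proof (rule red_eqI)
        fix j assume "j < n"
        then have "[(Q *\<^sub>v red (Q' *\<^sub>v v)) $ j = (Q *\<^sub>v (Q' *\<^sub>v v)) $ j] (mod m)"
          using Q(1) Q'(1) v(1) red
          by (intro cong_mult_mat_vec[of Q n n]) (auto simp del: index_mult_mat_vec)
        then show "[(Q *\<^sub>v red (Q' *\<^sub>v v)) $ j = v $ j] (mod m)"
          using inv v(1) by simp
      qed (use Q(1) Q'(1) v red in \<open>auto simp del: index_mult_mat_vec\<close>)
    qed
    show "(\<lambda>v. red (Q *\<^sub>v v)) ` kernel_mod m B \<subseteq> kernel_mod m A"
    proof clarify
      fix v assume "v \<in> kernel_mod m B"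
      then have v: "v \<in> carrier_vec n" "\<And>i. i < k \<Longrightarrow> [(B *\<^sub>v v) $ i = 0] (mod m)"
        by (auto simp: kerB simp del: index_mult_mat_vec)
      have Qv: "Q *\<^sub>v v \<in> carrier_vec n"
        using Q(1) v(1) by simp
      have "[(A *\<^sub>v red (Q *\<^sub>v v)) $ i = 0] (mod m)" if "i < k" for i
      proof -
        have "[(A *\<^sub>v red (Q *\<^sub>v v)) $ i = (A *\<^sub>v (Q *\<^sub>v v)) $ i] (mod m)"
          using A Qv red that by (intro cong_mult_mat_vec[of A k n]) (auto simp del: index_mult_mat_vec)
        also have "[(A *\<^sub>v (Q *\<^sub>v v)) $ i = 0] (mod m)"
          unfolding PAv[OF v(1), symmetric]
          using P'(1) carrB v that by (intro cong_mult_mat_vec_zero[of P' k k])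
            (auto simp del: index_mult_mat_vec)
        finally show ?thesis .
      qed
      with red Qv show "red (Q *\<^sub>v v) \<in> kernel_mod m A"
        by (auto simp: kerA simp del: index_mult_mat_vec)
    qed
    show "(\<lambda>v. red (Q' *\<^sub>v v)) ` kernel_mod m A \<subseteq> kernel_mod m B"
    proof clarify
      fix v assume "v \<in> kernel_mod m A"
      then have v: "v \<in> carrier_vec n" "\<And>i. i < k \<Longrightarrow> [(A *\<^sub>v v) $ i = 0] (mod m)"
        by (auto simp: kerA simp del: index_mult_mat_vec)
      have Qv: "Q' *\<^sub>v v \<in> carrier_vec n"
        using Q'(1) v(1) by simp
      have "[(B *\<^sub>v red (Q' *\<^sub>v v)) $ i = 0] (mod m)" if "i < k" for i
      proof -
        have "[(B *\<^sub>v red (Q' *\<^sub>v v)) $ i = (B *\<^sub>v (Q' *\<^sub>v v)) $ i] (mod m)"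
          using carrB Qv red that by (intro cong_mult_mat_vec[of B k n]) (auto simp del: index_mult_mat_vec)
        also have "[(B *\<^sub>v (Q' *\<^sub>v v)) $ i = 0] (mod m)"
          unfolding Bv[OF Qv] inv(2)[OF v(1)]
          using P(1) A v that by (intro cong_mult_mat_vec_zero[of P k k])
            (auto simp del: index_mult_mat_vec)
        finally show ?thesis .
      qed
      with red Qv show "red (Q' *\<^sub>v v) \<in> kernel_mod m B"
        by (auto simp: kerB simp del: index_mult_mat_vec)
    qed
  qed
  then show ?thesis
    by (rule bij_betw_same_card)
qed

text \<open>With \<open>g = gcd d m\<close> and \<open>q = m div g\<close>, the factor
  \<open>d div g\<close> is coprime to \<open>q\<close>, so the solutions are the multiples of
  \<open>q\<close>, of which \<open>g\<close> lie in the range. For \<open>d = 0\<close> this gives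
  \<open>q = 1\<close> and all \<open>m\<close> residues.\<close>

lemma card_mult_cong_zero:
  fixes d m :: int
  assumes "m > 0"
  shows "int (card {y \<in> {0..<m}. [d * y = 0] (mod m)}) = gcd d m"
proof -
  define g where "g = gcd d m"
  have g: "g > 0" "g dvd m" "g dvd d"
    using assms by (auto simp: g_def)
  define q where "q = m div g"
  have m: "m = g * q"
    using g by (simp add: q_def)
  then have q: "q > 0"
    using assms g(1) by (simp add: zero_less_mult_iff)
  have iff: "[d * y = 0] (mod m) \<longleftrightarrow> q dvd y" for y
  proof -
    have "coprime (d div g) q"
      using assms by (simp add: g_def q_def div_gcd_coprime)
    moreover have "m dvd d * y \<longleftrightarrow> g * q dvd g * ((d div g) * y)"
      using m g by (simp add: mult.assoc[symmetric])
    ultimately show ?thesis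
      using g(1) by (simp add: cong_0_iff coprime_dvd_mult_right_iff coprime_commute)
  qed
  have "bij_betw (\<lambda>t. q * t) {0..<g} {y \<in> {0..<m}. q dvd y}"
    by (rule bij_betw_byWitness[where f' = "\<lambda>y. y div q"])
      (use q m in \<open>auto simp: mult.commute mult_less_cancel_right_pos elim!: dvdE
        simp: zero_le_mult_iff\<close>)
  from bij_betw_same_card[OF this] have "card {y \<in> {0..<m}. q dvd y} = nat g"
    by simp
  then show ?thesis
    using g(1) by (simp add: iff g_def)
qed

text \<open>The equations decouple, so the kernel is a product of one solution set per
  coordinate.\<close>

lemma card_kernel_mod_diagonal:
  assumes D: "D \<in> carrier_mat n n" "diagonal_mat D" and "m > 0"
  shows "int (card (kernel_mod m D)) = (\<Prod>i<n. gcd (D $$ (i, i)) m)"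
proof -
  define S where "S i = {y \<in> {0..<m}. [D $$ (i, i) * y = 0] (mod m)}" for i
  have Dv: "(D *\<^sub>v v) $ i = D $$ (i, i) * v $ i" if "v \<in> carrier_vec n" "i < n" for v i
  proof -
    have "(D *\<^sub>v v) $ i = (\<Sum>j = 0..<n. D $$ (i, j) * v $ j)"
      using that D(1) by (auto simp: scalar_prod_def)
    also have "\<dots> = (\<Sum>j\<in>{i}. D $$ (i, j) * v $ j)"
      using that D by (intro sum.mono_neutral_right) (auto simp: diagonal_mat_def)
    finally show ?thesis
      by simp
  qed
  have "kernel_mod m D = {v \<in> carrier_vec n. \<forall>i<n. v $ i \<in> S i}"
    using D(1) Dv by (auto simp: kernel_mod_def S_def simp del: index_mult_mat_vec)
  \<comment> \<open>Vectors are turned into extensional functions so that the product can be counted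
    by \<open>card_PiE\<close>.\<close>
  then have "bij_betw (\<lambda>v. restrict (($) v) {..<n}) (kernel_mod m D) (PiE {..<n} S)"
    by (intro bij_betw_byWitness[where f' = "vec n"])
      (auto simp: PiE_def extensional_def fun_eq_iff Pi_def)
  then have "card (kernel_mod m D) = (\<Prod>i<n. card (S i))"
    by (simp add: bij_betw_same_card card_PiE)
  then show ?thesis
    using card_mult_cong_zero[OF assms(3)] by (simp add: S_def)
qed

theorem card_kernel_mod_smith:
  assumes "smith_normal_form_of A D" "A \<in> carrier_mat n n" "m > 0"
  shows "int (card (kernel_mod m A)) = (\<Prod>i<n. gcd (D $$ (i, i)) m)"
proof -
  have "equiv_mat A D" "diagonal_mat D"
    using assms(1) by (auto simp: smith_normal_form_of_iff)
  then show ?thesis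
    using card_kernel_mod_diagonal[of D n m] card_kernel_mod_equiv[of A D m] assms(2,3)
      equiv_mat_carrier[of A D n n] by simp
qed

section \<open>Quaternions modulo a power of two\<close>

lemma HZ_carrier: "carrier (HZ n) = {0..2 ^ n - 1} \<times> {0..2 ^ n - 1} \<times> {0..2 ^ n - 1} \<times> {0..2 ^ n - 1}"
  by (simp add: HZ_def quaternion_ring_def residue_ring_def)

lemma HZ_zero: "\<zero>\<^bsub>HZ n\<^esub> = (0, 0, 0, 0)"
  by (simp add: HZ_def quaternion_ring_def residue_ring_def)

lemma HZ_mult:
  assumes "n \<ge> 1"
  shows "(a1, a2, a3, a4) \<otimes>\<^bsub>HZ n\<^esub> (b1, b2, b3, b4) =
    ((a1 * b1 - a2 * b2 - a3 * b3 - a4 * b4) mod 2 ^ n,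
     (a2 * b1 + a1 * b2 - a4 * b3 + a3 * b4) mod 2 ^ n,
     (a3 * b1 + a4 * b2 + a1 * b3 - a2 * b4) mod 2 ^ n,
     (a4 * b1 - a3 * b2 + a2 * b3 + a1 * b4) mod 2 ^ n)"
proof -
  \<comment> \<open>The locale needs a modulus above 1, which \<open>n \<ge> 1\<close>
    provides.\<close>
  interpret residues "2 ^ n" "residue_ring (2 ^ n)"
    using assms by unfold_locales auto
  show ?thesis
    unfolding HZ_def quaternion_ring_def
    by (simp add: a_minus_def res_add_eq res_mult_eq res_neg_eq mod_simps)
qed

section \<open>Degrees by counting non-neighbours\<close>

lemma card_HZ_carrier: "card (carrier (HZ n)) = 2 ^ (4 * n)"
proof -
  have "card (carrier (HZ n)) = ((2 ^ n) ^ 4 :: nat)"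
    by (simp add: HZ_carrier card_cartesian_product nat_power_eq power4_eq_xxxx)
  then show ?thesis
    by (simp add: power_mult[symmetric] mult.commute)
qed

text \<open>The two conditionals are the sizes of \<open>U\<close>, the set of 1 and -1, and of
  \<open>X\<close>, which holds \<open>a\<close> when it is not already in \<open>B\<close>. The
  sets \<open>B\<close>, \<open>U\<close> and \<open>X\<close> are pairwise disjoint.\<close>

lemma Phi_deg_eq:
  assumes n: "n \<ge> 1" and a: "a \<in> Phi_verts n"
    and B: "B = {b \<in> carrier (HZ n). a \<otimes>\<^bsub>HZ n\<^esub> b = \<zero>\<^bsub>HZ n\<^esub>}"
  shows "int (Phi_deg n a) = 2 ^ (4 * n) - int (card B) - (if n = 1 then 1 else 2)
    - (if a \<otimes>\<^bsub>HZ n\<^esub> a = \<zero>\<^bsub>HZ n\<^esub> then 0 else 1)"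
proof -
  obtain a1 a2 a3 a4 where a_eq: "a = (a1, a2, a3, a4)"
    by (cases a)
  define U :: "(int \<times> int \<times> int \<times> int) set" where "U = {(1, 0, 0, 0), (2 ^ n - 1, 0, 0, 0)}"
  define X where "X = (if a \<otimes>\<^bsub>HZ n\<^esub> a = \<zero>\<^bsub>HZ n\<^esub> then {} else {a})"
  have range: "a1 \<in> {0..<2 ^ n}" "a2 \<in> {0..<2 ^ n}" "a3 \<in> {0..<2 ^ n}" "a4 \<in> {0..<2 ^ n}"
    and nz: "a \<noteq> (0, 0, 0, 0)" and aU: "a \<notin> U" and carr: "a \<in> carrier (HZ n)"
    using a by (auto simp: Phi_verts_def HZ_carrier U_def a_eq)
  have two: "(2 :: int) \<le> 2 ^ n"
    using n self_le_power[of "2 :: int" n] by simp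
  \<comment> \<open>Multiplication by \<open>2 ^ n - 1\<close> is negation modulo
    \<open>2 ^ n\<close>, so it sends only the residue 0 to 0.\<close>
  have neg: "x = 0" if "x \<in> {0..<2 ^ n}" "x * (2 ^ n - 1) mod 2 ^ n = 0" for x :: int
  proof -
    have "2 ^ n dvd x * 2 ^ n - x * (2 ^ n - 1)"
      using that(2) by (intro dvd_diff) (auto simp: dvd_eq_mod_eq_0)
    then have "2 ^ n dvd x"
      by (simp add: algebra_simps)
    with that(1) show ?thesis
      using zdvd_imp_le[of "2 ^ n" x] by force
  qed
  have "(a1, a2, a3, a4) \<otimes>\<^bsub>HZ n\<^esub> (1, 0, 0, 0) = (a1, a2, a3, a4)"
    using range by (simp add: HZ_mult[OF n])
  moreover have "(a1, a2, a3, a4) \<otimes>\<^bsub>HZ n\<^esub> (2 ^ n - 1, 0, 0, 0) \<noteq> (0, 0, 0, 0)"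
    using nz neg[OF range(1)] neg[OF range(2)] neg[OF range(3)] neg[OF range(4)]
    unfolding HZ_mult[OF n] a_eq by fastforce
  ultimately have UB: "U \<inter> B = {}"
    using nz unfolding U_def B a_eq HZ_zero by simp
  have XB: "X \<inter> B = {}" and XU: "X \<inter> U = {}"
    using aU by (auto simp: X_def B)
  have UC: "U \<subseteq> carrier (HZ n)"
    using two by (auto simp: U_def HZ_carrier)
  have BC: "B \<subseteq> carrier (HZ n)"
    by (auto simp: B)
  have fin: "finite (carrier (HZ n))"
    by (simp add: HZ_carrier)
  have sub: "B \<union> U \<union> X \<subseteq> carrier (HZ n)"
    using UC BC carr by (auto simp: X_def)
  \<comment> \<open>The excluded non-vertices are 0, 1 and -1. Since 0 lies in \<open>B\<close>,
    removing \<open>B\<close> and \<open>U\<close> takes care of all three.\<close>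
  have "(0, 0, 0, 0) \<in> B"
    using two by (simp add: B a_eq HZ_mult[OF n] HZ_zero HZ_carrier)
  then have "{b. Phi_adj n a b} = carrier (HZ n) - (B \<union> U \<union> X)"
    using a by (auto simp: Phi_adj_def Phi_verts_def B U_def X_def)
  then have "Phi_deg n a = card (carrier (HZ n)) - card (B \<union> U \<union> X)"
    using card_Diff_subset[OF finite_subset[OF sub fin] sub] by (simp add: Phi_deg_def)
  moreover have "card (B \<union> U \<union> X) = card B + card U + card X"
    using UB XB XU finite_subset[OF BC fin] finite_subset[OF UC fin]
    by (subst card_Un_disjoint, auto simp: X_def, subst card_Un_disjoint, auto)
  \<comment> \<open>With this bound the subtraction of natural numbers agrees with the one in the
    integers.\<close>
  moreover have "card (B \<union> U \<union> X) \<le> card (carrier (HZ n))"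
    using sub fin by (rule card_mono[rotated])
  \<comment> \<open>For \<open>n = 1\<close> the residue \<open>2 ^ n - 1\<close> is 1 itself; for
    larger \<open>n\<close> it is at least 3.\<close>
  moreover have "card U = (if n = 1 then 1 else 2)"
  proof (cases "n = 1")
    case False
    then have "(2 :: int) ^ 2 \<le> 2 ^ n"
      using n by (intro power_increasing) auto
    with False show ?thesis
      by (simp add: U_def)
  qed (simp add: U_def)
  ultimately show ?thesis
    by (auto simp: card_HZ_carrier X_def)
qed

section \<open>The annihilator as a kernel modulo \<open>2 ^ n\<close>\<close>

lemma coeff_mat_carrier: "coeff_mat a1 a2 a3 a4 \<in> carrier_mat 4 4"
  by (auto simp: coeff_mat_def mat_of_rows_list_def)

text \<open>The rows of the coefficient matrix applied to \<open>b\<close> are the four coordinates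
  of the product before reduction. Replacing the \<open>a\<close> coordinates by other integer
  representatives changes these only by multiples of \<open>2 ^ n\<close>.\<close>

lemma card_annihilator_eq_kernel_mod:
  assumes n: "n \<ge> 1"
    and r: "[r1 = a1] (mod 2 ^ n)" "[r2 = a2] (mod 2 ^ n)" "[r3 = a3] (mod 2 ^ n)" "[r4 = a4] (mod 2 ^ n)"
  shows "card {b \<in> carrier (HZ n). (a1, a2, a3, a4) \<otimes>\<^bsub>HZ n\<^esub> b = \<zero>\<^bsub>HZ n\<^esub>} =
    card (kernel_mod (2 ^ n) (coeff_mat r1 r2 r3 r4))" (is "card ?B = card ?K")
proof -
  let ?A = "coeff_mat r1 r2 r3 r4"
  let ?v = "\<lambda>(b1, b2, b3, b4). vec_of_list [b1, b2, b3, b4]"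
  note A = coeff_mat_carrier[of r1 r2 r3 r4]
  have less4: "(\<forall>i<4. P i) \<longleftrightarrow> P 0 \<and> P 1 \<and> P 2 \<and> P (3 :: nat)" for P
    by (auto simp: numeral_eq_Suc less_Suc_eq)
  have Av: "(?A *\<^sub>v ?v (b1, b2, b3, b4)) $ 0 = r1 * b1 - r2 * b2 - r3 * b3 - r4 * b4"
    "(?A *\<^sub>v ?v (b1, b2, b3, b4)) $ 1 = r2 * b1 + r1 * b2 - r4 * b3 + r3 * b4"
    "(?A *\<^sub>v ?v (b1, b2, b3, b4)) $ 2 = r3 * b1 + r4 * b2 + r1 * b3 - r2 * b4"
    "(?A *\<^sub>v ?v (b1, b2, b3, b4)) $ 3 = r4 * b1 - r3 * b2 + r2 * b3 + r1 * b4" for b1 b2 b3 b4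
    by (simp_all add: coeff_mat_def mat_of_rows_list_def scalar_prod_def row_def
        numeral_eq_Suc vec_of_list_index)
  have mult: "(a1, a2, a3, a4) \<otimes>\<^bsub>HZ n\<^esub> b = \<zero>\<^bsub>HZ n\<^esub> \<longleftrightarrow>
    (\<forall>i<4. [(?A *\<^sub>v ?v b) $ i = 0] (mod 2 ^ n))" for b
  proof -
    obtain b1 b2 b3 b4 where b: "b = (b1, b2, b3, b4)"
      by (cases b)
    have "[r1 * b1 - r2 * b2 - r3 * b3 - r4 * b4 = a1 * b1 - a2 * b2 - a3 * b3 - a4 * b4] (mod 2 ^ n)"
      "[r2 * b1 + r1 * b2 - r4 * b3 + r3 * b4 = a2 * b1 + a1 * b2 - a4 * b3 + a3 * b4] (mod 2 ^ n)"
      "[r3 * b1 + r4 * b2 + r1 * b3 - r2 * b4 = a3 * b1 + a4 * b2 + a1 * b3 - a2 * b4] (mod 2 ^ n)"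
      "[r4 * b1 - r3 * b2 + r2 * b3 + r1 * b4 = a4 * b1 - a3 * b2 + a2 * b3 + a1 * b4] (mod 2 ^ n)"
      by (intro cong_add cong_diff cong_mult r cong_refl)+
    then show ?thesis
      unfolding b less4 Av HZ_mult[OF n] HZ_zero by (simp add: cong_def)
  qed
  have "bij_betw ?v ?B ?K"
  proof (rule bij_betw_byWitness[where f' = "\<lambda>v. (v $ 0, v $ 1, v $ 2, v $ 3)"])
    have vec4: "?v (v $ 0, v $ 1, v $ 2, v $ 3) = v" if "v \<in> carrier_vec 4" for v :: "int vec"
      using that by (intro eq_vecI) (auto simp: numeral_eq_Suc less_Suc_eq vec_of_list_index)
    show "\<forall>b\<in>?B. (\<lambda>v. (v $ 0, v $ 1, v $ 2, v $ 3)) (?v b) = b"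
      by (auto simp: vec_of_list_index numeral_eq_Suc)
    show "\<forall>v\<in>?K. ?v (v $ 0, v $ 1, v $ 2, v $ 3) = v"
      unfolding kernel_mod_def carrier_matD[OF A] using vec4 by blast
    show "?v ` ?B \<subseteq> ?K"
    proof (rule image_subsetI)
      fix b assume "b \<in> ?B"
      then have b: "b \<in> carrier (HZ n)" "\<forall>i<4. [(?A *\<^sub>v ?v b) $ i = 0] (mod 2 ^ n)"
        using mult by auto
      obtain b1 b2 b3 b4 where eq: "b = (b1, b2, b3, b4)"
        by (cases b)
      have "?v b $ 0 = b1" "?v b $ 1 = b2" "?v b $ 2 = b3" "?v b $ 3 = b4"
        by (simp_all add: eq vec_of_list_index numeral_eq_Suc)
      with b(1) have "\<forall>j<4. ?v b $ j \<in> {0..<2 ^ n}"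
        unfolding less4 eq HZ_carrier by simp
      moreover have "?v b \<in> carrier_vec 4"
        unfolding eq by (intro carrier_vecI) simp
      ultimately show "?v b \<in> ?K"
        unfolding kernel_mod_def carrier_matD[OF A] using b(2) by blast
    qed
    show "(\<lambda>v. (v $ 0, v $ 1, v $ 2, v $ 3)) ` ?K \<subseteq> ?B"
    proof (rule image_subsetI)
      fix v assume "v \<in> ?K"
      then have v: "v \<in> carrier_vec 4" "\<forall>j<4. v $ j \<in> {0..<2 ^ n}"
        "\<forall>i<4. [(?A *\<^sub>v v) $ i = 0] (mod 2 ^ n)"
        unfolding kernel_mod_def carrier_matD[OF A] by blast+
      from v(2) have "(v $ 0, v $ 1, v $ 2, v $ 3) \<in> carrier (HZ n)"
        unfolding less4 by (simp add: HZ_carrier)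
      with v(3) show "(v $ 0, v $ 1, v $ 2, v $ 3) \<in> ?B"
        unfolding mem_Collect_eq mult vec4[OF v(1)] by simp
    qed
  qed
  then show ?thesis
    by (rule bij_betw_same_card)
qed

text \<open>The product formula is asserted for all integer representatives and every Smith normal
  form. The sign ambiguity of the diagonal is harmless because \<open>gcd\<close> ignores signs, and
  the existence claim keeps the formula from being vacuous. Degrees are compared in the integers to
  avoid truncated subtraction.\<close>

theorem theorem4p5:
  fixes n :: nat and a1 a2 a3 a4 :: int
    and a :: "int \<times> int \<times> int \<times> int" and B :: "(int \<times> int \<times> int \<times> int) set"
  assumes "n \<ge> 1"
    and "a = (a1, a2, a3, a4)"
    and "a \<in> Phi_verts n"
    and "B = {b \<in> carrier (HZ n). a \<otimes>\<^bsub>HZ n\<^esub> b = \<zero>\<^bsub>HZ n\<^esub>}"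
  shows "(n = 1 \<longrightarrow>
            (a \<otimes>\<^bsub>HZ n\<^esub> a = \<zero>\<^bsub>HZ n\<^esub> \<longrightarrow> int (Phi_deg n a) = 2 ^ (4 * n) - int (card B) - 1) \<and>
            (a \<otimes>\<^bsub>HZ n\<^esub> a \<noteq> \<zero>\<^bsub>HZ n\<^esub> \<longrightarrow> int (Phi_deg n a) = 2 ^ (4 * n) - int (card B) - 2)) \<and>
         (n > 1 \<longrightarrow>
            (a \<otimes>\<^bsub>HZ n\<^esub> a = \<zero>\<^bsub>HZ n\<^esub> \<longrightarrow> int (Phi_deg n a) = 2 ^ (4 * n) - int (card B) - 2) \<and>
            (a \<otimes>\<^bsub>HZ n\<^esub> a \<noteq> \<zero>\<^bsub>HZ n\<^esub> \<longrightarrow> int (Phi_deg n a) = 2 ^ (4 * n) - int (card B) - 3)) \<and>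
         (\<forall>r1 r2 r3 r4 :: int.
            [r1 = a1] (mod 2 ^ n) \<and> [r2 = a2] (mod 2 ^ n) \<and>
            [r3 = a3] (mod 2 ^ n) \<and> [r4 = a4] (mod 2 ^ n) \<longrightarrow>
            (\<exists>D. smith_normal_form_of (coeff_mat r1 r2 r3 r4) D) \<and>
            (\<forall>D. smith_normal_form_of (coeff_mat r1 r2 r3 r4) D \<longrightarrow>
               int (card B) = (\<Prod>i<4. gcd (D $$ (i, i)) (2 ^ n))))"
proof (intro conjI allI impI)
  note deg = Phi_deg_eq[OF assms(1,3,4)]
  show "int (Phi_deg n a) = 2 ^ (4 * n) - int (card B) - 1"
    if "n = 1" "a \<otimes>\<^bsub>HZ n\<^esub> a = \<zero>\<^bsub>HZ n\<^esub>"
    using deg that by simp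
  show "int (Phi_deg n a) = 2 ^ (4 * n) - int (card B) - 2"
    if "n = 1" "a \<otimes>\<^bsub>HZ n\<^esub> a \<noteq> \<zero>\<^bsub>HZ n\<^esub>"
    using deg that by simp
  show "int (Phi_deg n a) = 2 ^ (4 * n) - int (card B) - 2"
    if "n > 1" "a \<otimes>\<^bsub>HZ n\<^esub> a = \<zero>\<^bsub>HZ n\<^esub>"
    using deg that by simp
  show "int (Phi_deg n a) = 2 ^ (4 * n) - int (card B) - 3"
    if "n > 1" "a \<otimes>\<^bsub>HZ n\<^esub> a \<noteq> \<zero>\<^bsub>HZ n\<^esub>"
    using deg that by simp
next
  fix r1 r2 r3 r4 :: int
  show "\<exists>D. smith_normal_form_of (coeff_mat r1 r2 r3 r4) D"
    by (rule smith_normal_form_exists)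
  fix D
  assume r: "[r1 = a1] (mod 2 ^ n) \<and> [r2 = a2] (mod 2 ^ n) \<and>
      [r3 = a3] (mod 2 ^ n) \<and> [r4 = a4] (mod 2 ^ n)"
    and D: "smith_normal_form_of (coeff_mat r1 r2 r3 r4) D"
  have "card B = card (kernel_mod (2 ^ n) (coeff_mat r1 r2 r3 r4))"
    unfolding assms(2,4) using r assms(1) by (intro card_annihilator_eq_kernel_mod) auto
  then show "int (card B) = (\<Prod>i<4. gcd (D $$ (i, i)) (2 ^ n))"
    using card_kernel_mod_smith[OF D coeff_mat_carrier, of "2 ^ n"] by simp
qed

end
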